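(* If $0<V_0\le V$ are finite-dimensional vector spaces over a field $\mathbb{F}\neq\mathbb{F}_2$, then the coinvariants $\operatorname{St}(V,V_0)_{A^T(V,V_0)}$ vanish.
   Context: $\mathcal{P}(V,V_0)$ is the poset, ordered by inclusion, of proper subspaces $W<V$ with $W+V_0=V$; $\operatorname{St}(V,V_0)=\tilde H_{\dim V_0-1}(\mathcal{P}(V,V_0);\mathbb{Z})$. The group $A^T(V,V_0)$ is the subgroup of $g\in\operatorname{GL}(V)$ with $gV_0=V_0$ and inducing the identity on $V/V_0$ (equivalently $g(v)-v\in V_0$ for all $v$); it acts on $\mathcal{P}(V,V_0)$ and hence on $\operatorname{St}(V,V_0)$. *)

theory Defs
  imports Complex_Main
begin

definition subspace_sum :: "'v::ab_group_add set \<Rightarrow> 'v set \<Rightarrow> 'v set" where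
  "subspace_sum W U = {w + u | w u. w \<in> W \<and> u \<in> U}"

definition Pposet :: "('f::field \<Rightarrow> 'v::ab_group_add \<Rightarrow> 'v) \<Rightarrow> 'v set \<Rightarrow> 'v set \<Rightarrow> 'v set set" where
  "Pposet scale V V0 =
     {W. Modules.module.subspace scale W \<and> W \<subseteq> V \<and> W \<noteq> V \<and> subspace_sum W V0 = V}"

text \<open>Simplices with k vertices (dimension k-1) are strictly increasing lists of k elements;
  the empty list is the unique (-1)-simplex of the augmentation.\<close>
definition simplices :: "'a set set \<Rightarrow> nat \<Rightarrow> 'a set list set" where
  "simplices P k = {xs. sorted_wrt (\<subset>) xs \<and> set xs \<subseteq> P \<and> length xs = k}"

definition chains :: "'a set set \<Rightarrow> nat \<Rightarrow> ('a set list \<Rightarrow> int) set" where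
  "chains P k = {c. finite {s. c s \<noteq> 0} \<and> (\<forall>s. c s \<noteq> 0 \<longrightarrow> s \<in> simplices P k)}"

definition del_nth :: "nat \<Rightarrow> 'b list \<Rightarrow> 'b list" where
  "del_nth i xs = take i xs @ drop (Suc i) xs"

text \<open>Simplicial boundary: d[x_0<...<x_n] = sum_i (-1)^i [x_0<..^x_i..<x_n]
  (for vertices this is the augmentation).\<close>
definition bdry :: "('b list \<Rightarrow> int) \<Rightarrow> ('b list \<Rightarrow> int)" where
  "bdry c = (\<lambda>t. \<Sum>s\<in>{s. c s \<noteq> 0}.
                 c s * (\<Sum>i\<in>{i. i < length s \<and> del_nth i s = t}. (-1) ^ i))"

definition cycles :: "'a set set \<Rightarrow> nat \<Rightarrow> ('a set list \<Rightarrow> int) set" where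
  "cycles P k = {c \<in> chains P k. bdry c = (\<lambda>_. 0)}"

definition boundaries :: "'a set set \<Rightarrow> nat \<Rightarrow> ('a set list \<Rightarrow> int) set" where
  "boundaries P k = bdry ` chains P (Suc k)"

definition push :: "('b \<Rightarrow> 'b) \<Rightarrow> ('b list \<Rightarrow> int) \<Rightarrow> ('b list \<Rightarrow> int)" where
  "push f c = (\<lambda>t. \<Sum>s\<in>{s. c s \<noteq> 0 \<and> map f s = t}. c s)"

inductive_set zspan :: "('b \<Rightarrow> int) set \<Rightarrow> ('b \<Rightarrow> int) set" for S where
  zero: "(\<lambda>_. 0) \<in> zspan S"
| gen: "x \<in> S \<Longrightarrow> x \<in> zspan S"
| neg: "x \<in> zspan S \<Longrightarrow> (\<lambda>t. - x t) \<in> zspan S"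
| add: "x \<in> zspan S \<Longrightarrow> y \<in> zspan S \<Longrightarrow> (\<lambda>t. x t + y t) \<in> zspan S"

text \<open>Reduced homology in degree k-1 is cycles P k / boundaries P k.  Its coinvariants
  under a group G acting on P (via act) are that quotient modulo the subgroup generated by
  the classes g.[z]-[z]; they vanish iff every k-vertex cycle lies in
  boundaries + span{g.z - z}.\<close>
definition coinvariants_vanish ::
  "'a set set \<Rightarrow> nat \<Rightarrow> 'g set \<Rightarrow> ('g \<Rightarrow> 'a set \<Rightarrow> 'a set) \<Rightarrow> bool" where
  "coinvariants_vanish P k G act \<longleftrightarrow>
     cycles P k \<subseteq> {(\<lambda>t. b t + d t) | b d. b \<in> boundaries P k \<and>
        d \<in> zspan {(\<lambda>t. push (act g) z t - z t) | g z. g \<in> G \<and> z \<in> cycles P k}}"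

definition AT :: "('f::field \<Rightarrow> 'v::ab_group_add \<Rightarrow> 'v) \<Rightarrow> 'v set \<Rightarrow> 'v set \<Rightarrow> ('v \<Rightarrow> 'v) set" where
  "AT scale V V0 = {g. Vector_Spaces.linear scale scale g \<and> bij_betw g V V \<and> g ` V0 = V0
                       \<and> (\<forall>v\<in>V. g v - v \<in> V0)}"

end

theory Submission
  imports Defs "HOL-Library.Poly_Mapping"
begin

text \<open>
  Fix a nonzero \<open>e \<in> V0\<close>. A hyperplane \<open>H\<close> of \<open>V\<close> not containing \<open>e\<close> defines a cone operator on
  chains of flags whose members all contain \<open>e\<close>, through the homotopy
  \<open>F \<supseteq> F \<inter> H \<subseteq> H\<close>. Every top-dimensional cycle is a sum of cones \<open>C\<^sub>H(y\<^sub>H)\<close> over such hyperplanes,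
  where the \<open>y\<^sub>H\<close> are cycles with sum zero: the cycle minus its cones has no flag whose
  largest member avoids \<open>e\<close>, and a top-dimensional chain of this kind with boundary in the flags
  through \<open>e\<close> is zero. So it is a sum of differences \<open>C\<^sub>H(y) - C\<^sub>K(y)\<close>. The maps
  \<open>v \<mapsto> v + \<phi>(v) e\<close> fix every subspace containing \<open>e\<close> and permute these differences; they act on the
  pencil spanned by \<open>H\<close> and \<open>K\<close> as the affine group of the field, which kills the differences
  in the coinvariants as soon as there is a scalar other than \<open>0\<close> and \<open>1\<close>.
\<close>

section \<open>Chains as elements of free abelian groups\<close>

abbreviation cons_frag :: "'b \<Rightarrow> ('b list \<Rightarrow>\<^sub>0 int) \<Rightarrow> ('b list \<Rightarrow>\<^sub>0 int)" where
  "cons_frag x \<equiv> frag_extend (\<lambda>s. frag_of (x # s))"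

text \<open>The recursive form suits induction on flags: a deletion in the tail sits one position
  further along in the whole list, whence the minus sign. \<open>lookup_list_bd\<close> matches it
  with the alternating sum in \<open>bdry\<close>.\<close>

fun list_bd :: "'b list \<Rightarrow> ('b list \<Rightarrow>\<^sub>0 int)" where
  "list_bd [] = 0"
| "list_bd (x # s) = frag_of s - cons_frag x (list_bd s)"

abbreviation frag_bd :: "('b list \<Rightarrow>\<^sub>0 int) \<Rightarrow> ('b list \<Rightarrow>\<^sub>0 int)" where
  "frag_bd \<equiv> frag_extend list_bd"

lemma lookup_frag_extend:
  "Poly_Mapping.lookup (frag_extend f c) t =
     (\<Sum>s\<in>Poly_Mapping.keys c. Poly_Mapping.lookup c s * Poly_Mapping.lookup (f s) t)"
  by (simp add: frag_extend_def lookup_sum)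

lemma frag_extend_cong_on:
  assumes "Poly_Mapping.keys c \<subseteq> S" and "\<And>s. s \<in> S \<Longrightarrow> f s = g s"
  shows "frag_extend f c = frag_extend g c"
  using assms by (intro frag_extend_eq) auto

lemma frag_extend_comp:
  "frag_extend f (frag_extend g c) = frag_extend (\<lambda>s. frag_extend f (g s)) c"
proof -
  have "Poly_Mapping.keys c \<subseteq> UNIV" by simp
  then show ?thesis
    by (induction c rule: frag_induction) (auto simp: frag_extend_diff)
qed

lemma frag_extend_map_add:
  "frag_extend (\<lambda>s. f s + g s) c = frag_extend f c + frag_extend g c"
  by (simp add: frag_extend_def frag_cmul_distrib2 sum.distrib)

lemma frag_extend_map_sum:
  "finite I \<Longrightarrow> frag_extend (\<lambda>s. \<Sum>i\<in>I. f i s) c = (\<Sum>i\<in>I. frag_extend (f i) c)"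
proof (induction I rule: finite_induct)
  case empty
  show ?case by (simp add: frag_extend_eq_0)
next
  case (insert x I)
  then show ?case by (simp add: frag_extend_map_add)
qed

lemma frag_extend_map_cmul:
  "frag_extend (\<lambda>s. frag_cmul k (f s)) c = frag_cmul k (frag_extend f c)"
  by (simp add: frag_extend_def frag_cmul_sum mult.commute)

lemma keys_frag_extend_subset:
  assumes "Poly_Mapping.keys c \<subseteq> S" and "\<And>s. s \<in> S \<Longrightarrow> Poly_Mapping.keys (f s) \<subseteq> T"
  shows "Poly_Mapping.keys (frag_extend f c) \<subseteq> T"
  using keys_frag_extend[of f c] assms by blast

lemma keys_frag_diff_subset:
  "Poly_Mapping.keys a \<subseteq> S \<Longrightarrow> Poly_Mapping.keys b \<subseteq> S \<Longrightarrow> Poly_Mapping.keys (a - b) \<subseteq> S"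
  using keys_diff[of a b] by blast

lemma lookup_cons_frag:
  "Poly_Mapping.lookup (cons_frag x c) t =
     (case t of [] \<Rightarrow> 0 | y # u \<Rightarrow> if y = x then Poly_Mapping.lookup c u else 0)"
proof -
  have "Poly_Mapping.keys c \<subseteq> UNIV" by simp
  then show ?thesis
    by (induction c rule: frag_induction)
       (auto simp: frag_extend_diff lookup_minus split: list.splits)
qed

lemma del_nth_Cons_0: "del_nth 0 (x # s) = s"
  and del_nth_Cons_Suc: "del_nth (Suc i) (x # s) = x # del_nth i s"
  by (simp_all add: del_nth_def)

lemma lookup_list_bd:
  "Poly_Mapping.lookup (list_bd s) t = (\<Sum>i\<in>{i. i < length s \<and> del_nth i s = t}. (- 1) ^ i)"
proof -
  have "Poly_Mapping.lookup (list_bd s) t = (\<Sum>i<length s. if del_nth i s = t then (- 1) ^ i else 0)"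
  proof (induction s arbitrary: t)
    case Nil
    show ?case by simp
  next
    case (Cons x s)
    have "(\<Sum>i<length (x # s). if del_nth i (x # s) = t then (- 1) ^ i else 0) =
        (if s = t then 1 else 0) +
        (\<Sum>i<length s. if x # del_nth i s = t then - ((- 1) ^ i) else (0::int))"
      by (simp only: length_Cons sum.lessThan_Suc_shift del_nth_Cons_0 del_nth_Cons_Suc
          power_0 power_Suc mult_minus1)
    also have "(\<Sum>i<length s. if x # del_nth i s = t then - ((- 1) ^ i) else (0::int)) =
        - Poly_Mapping.lookup (cons_frag x (list_bd s)) t"
    proof (cases t)
      case Nil
      then show ?thesis by (simp add: lookup_cons_frag)
    next
      case (Cons y u)
      have "(if x # del_nth i s = t then - ((- 1) ^ i) else (0::int)) =
          - (if y = x then if del_nth i s = u then (- 1) ^ i else 0 else 0)" for i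
        using Cons by simp
      then show ?thesis
        using Cons Cons.IH[of u] by (simp only: lookup_cons_frag sum_negf) simp
    qed
    finally show ?case
      by (simp add: lookup_minus)
  qed
  then show ?thesis
    by (simp add: sum.If_cases Int_def)
qed

section \<open>Translation of the chains of the statement into the free abelian group\<close>

lemma bdry_lookup: "bdry (Poly_Mapping.lookup c) = Poly_Mapping.lookup (frag_bd c)"
proof
  fix t
  have "{s. Poly_Mapping.lookup c s \<noteq> 0} = Poly_Mapping.keys c"
    by (auto simp: in_keys_iff)
  then show "bdry (Poly_Mapping.lookup c) t = Poly_Mapping.lookup (frag_bd c) t"
    by (simp add: bdry_def lookup_frag_extend lookup_list_bd)
qed

lemma push_lookup: "push f (Poly_Mapping.lookup c) = Poly_Mapping.lookup (frag_extend (\<lambda>s. frag_of (map f s)) c)"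
proof
  fix t
  have "{s. Poly_Mapping.lookup c s \<noteq> 0 \<and> map f s = t} = {s \<in> Poly_Mapping.keys c. map f s = t}"
    by (auto simp: in_keys_iff)
  then show "push f (Poly_Mapping.lookup c) t = Poly_Mapping.lookup (frag_extend (\<lambda>s. frag_of (map f s)) c) t"
    by (simp add: push_def lookup_frag_extend sum.inter_filter) (auto intro!: sum.cong)
qed

text \<open>Finite support is exactly what \<open>Abs_poly_mapping\<close> requires, so functions
  and elements of the free abelian group correspond.\<close>

lemma in_chains_iff:
  "c \<in> chains P k \<longleftrightarrow> (\<exists>x. c = Poly_Mapping.lookup x \<and> Poly_Mapping.keys x \<subseteq> simplices P k)"
proof
  assume c: "c \<in> chains P k"
  then have "Poly_Mapping.lookup (Abs_poly_mapping c) = c"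
    by (intro lookup_Abs_poly_mapping) (simp add: chains_def)
  moreover from this c have "Poly_Mapping.keys (Abs_poly_mapping c) \<subseteq> simplices P k"
    by (auto simp: chains_def in_keys_iff)
  ultimately show "\<exists>x. c = Poly_Mapping.lookup x \<and> Poly_Mapping.keys x \<subseteq> simplices P k" by metis
next
  assume "\<exists>x. c = Poly_Mapping.lookup x \<and> Poly_Mapping.keys x \<subseteq> simplices P k"
  then obtain x where x: "c = Poly_Mapping.lookup x" "Poly_Mapping.keys x \<subseteq> simplices P k" by blast
  have "{s. Poly_Mapping.lookup x s \<noteq> 0} = Poly_Mapping.keys x"
    by (auto simp: in_keys_iff)
  with x show "c \<in> chains P k"
    by (auto simp: chains_def in_keys_iff)
qed

lemma lookup_eq_zero_fun: "Poly_Mapping.lookup x = (\<lambda>_. 0) \<longleftrightarrow> x = 0"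
  by (metis lookup_inject lookup_zero poly_mapping_eqI)

lemma in_cycles_iff:
  "c \<in> cycles P k \<longleftrightarrow>
     (\<exists>x. c = Poly_Mapping.lookup x \<and> Poly_Mapping.keys x \<subseteq> simplices P k \<and> frag_bd x = 0)"
  by (auto simp: cycles_def in_chains_iff bdry_lookup lookup_eq_zero_fun)

text \<open>The boundary summand is chosen to be \<open>0\<close>: in the degree of the theorem
  flags have maximal length, so the homology group is the group of cycles itself.\<close>

lemma coinvariants_vanishI:
  assumes "\<And>x. Poly_Mapping.keys x \<subseteq> simplices P k \<Longrightarrow> frag_bd x = 0 \<Longrightarrow>
    Poly_Mapping.lookup x \<in> zspan {(\<lambda>t. push (act g) z t - z t) | g z. g \<in> G \<and> z \<in> cycles P k}"
  shows "coinvariants_vanish P k G act"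
proof -
  have zero: "(\<lambda>_. 0) \<in> boundaries P k"
  proof -
    have "(\<lambda>_. 0) = Poly_Mapping.lookup (0 :: 'a set list \<Rightarrow>\<^sub>0 int)" by (auto simp: fun_eq_iff)
    then have "(\<lambda>_. 0) \<in> chains P (Suc k)" by (auto simp: in_chains_iff intro!: exI[of _ 0])
    moreover have "bdry (\<lambda>_ :: 'a set list. 0) = (\<lambda>_. 0)" by (simp add: bdry_def)
    ultimately show ?thesis unfolding boundaries_def by (intro image_eqI[where x = "\<lambda>_. 0"]) simp_all
  qed
  show ?thesis
    unfolding coinvariants_vanish_def
  proof (rule subsetI, unfold mem_Collect_eq)
    fix c :: "'a set list \<Rightarrow> int"
    let ?D = "{(\<lambda>t. push (act g) z t - z t) | g z. g \<in> G \<and> z \<in> cycles P k}"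
    assume "c \<in> cycles P k"
    then obtain x where x: "c = Poly_Mapping.lookup x"
      and "Poly_Mapping.keys x \<subseteq> simplices P k" "frag_bd x = 0"
      unfolding in_cycles_iff by blast
    then have "c \<in> zspan ?D"
      unfolding x by (intro assms)
    with zero have "c = (\<lambda>t. (\<lambda>_. 0) t + c t) \<and> (\<lambda>_. 0) \<in> boundaries P k \<and> c \<in> zspan ?D"
      by simp
    then show "\<exists>b d. c = (\<lambda>t. b t + d t) \<and> b \<in> boundaries P k \<and> d \<in> zspan ?D"
      by (intro exI)
  qed
qed

text \<open>Expansion at the last entry, for the residues, which single out the largest member of a
  flag.\<close>

lemma list_bd_snoc:
  "list_bd (s @ [x]) =
     frag_extend (\<lambda>u. frag_of (u @ [x])) (list_bd s) + frag_cmul ((- 1) ^ length s) (frag_of s)"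
proof (induction s)
  case Nil
  show ?case by simp
next
  case (Cons a s)
  then show ?case
    by (simp add: frag_extend_add frag_extend_diff frag_extend_comp frag_extend_cmul)
qed

lemma list_bd_map: "list_bd (map f s) = frag_extend (\<lambda>u. frag_of (map f u)) (list_bd s)"
  by (induction s) (simp_all add: frag_extend_diff frag_extend_comp)

lemma keys_cons_frag: "Poly_Mapping.keys (cons_frag x c) \<subseteq> (#) x ` Poly_Mapping.keys c"
  using keys_frag_extend[of "\<lambda>s. frag_of (x # s)" c] by auto

lemma lookup_frag_filter:
  "Poly_Mapping.lookup (frag_extend (\<lambda>s. if Q s then frag_of s else 0) c) t =
     (if Q t then Poly_Mapping.lookup c t else 0)"
proof -
  have "Poly_Mapping.keys c \<subseteq> UNIV" by simp
  then show ?thesis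
    by (induction c rule: frag_induction) (auto simp: frag_extend_diff lookup_minus)
qed

section \<open>The cone operator of a complementary hyperplane\<close>

text \<open>The homotopy \<open>F \<supseteq> F \<inter> H \<subseteq> H\<close> contracts flags of subspaces containing a fixed line
  to the complementary hyperplane \<open>H\<close>.\<close>

fun flag_cone :: "'a set \<Rightarrow> 'a set list \<Rightarrow> ('a set list \<Rightarrow>\<^sub>0 int)" where
  "flag_cone H [] = frag_of [H]"
| "flag_cone H (x # xs) = frag_of ((x \<inter> H) # x # xs) - cons_frag (x \<inter> H) (flag_cone H xs)"

lemma frag_bd_cons_frag: "frag_bd (cons_frag x c) = c - cons_frag x (frag_bd c)"
proof -
  have "Poly_Mapping.keys c \<subseteq> UNIV" by simp
  then show ?thesis
    by (induction c rule: frag_induction) (auto simp: frag_extend_diff)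
qed

lemma flag_cone_cons_frag:
  "frag_extend (flag_cone H) (cons_frag x c) =
     cons_frag (x \<inter> H) (cons_frag x c) - cons_frag (x \<inter> H) (frag_extend (flag_cone H) c)"
proof -
  have "Poly_Mapping.keys c \<subseteq> UNIV" by simp
  then show ?thesis
    by (induction c rule: frag_induction) (auto simp: frag_extend_diff)
qed

text \<open>The homotopy identity \<open>d C + C d = id\<close>, with the augmentation included
  because the empty flag is sent to the vertex \<open>H\<close>. In the induction the two copies of
  \<open>(x \<inter> H) # s\<close> cancel. Hence the cone of a cycle \<open>y\<close> has boundary
  \<open>y\<close>.\<close>

lemma frag_bd_flag_cone:
  "frag_bd (flag_cone H s) = frag_of s - frag_extend (flag_cone H) (list_bd s)"
proof (induction s)
  case Nil
  show ?case by simp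
next
  case (Cons x s)
  then show ?case
    by (simp add: frag_extend_diff frag_bd_cons_frag flag_cone_cons_frag)
qed

lemma frag_bd_extend_flag_cone:
  "frag_bd (frag_extend (flag_cone H) c) = c - frag_extend (flag_cone H) (frag_bd c)"
proof -
  have "Poly_Mapping.keys c \<subseteq> UNIV" by simp
  then show ?thesis
    by (induction c rule: frag_induction) (auto simp: frag_extend_diff frag_bd_flag_cone)
qed

section \<open>Subspaces relative to a line\<close>

context vector_space
begin

lemma in_span_insert_iff: "subspace W \<Longrightarrow> x \<in> span (insert a W) \<longleftrightarrow> (\<exists>k. x - k *s a \<in> W)"
  unfolding span_insert mem_Collect_eq by (simp only: span_eq_iff[THEN iffD2])

lemma subspace_diffD: "subspace W \<Longrightarrow> x \<in> W \<Longrightarrow> x - y \<in> W \<Longrightarrow> y \<in> W"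
  using subspace_diff[of W x "x - y"] by simp

text \<open>The type \<open>'v\<close> may be infinite-dimensional, so finiteness enters through a
  finite set \<open>B\<close> with a large enough span.\<close>

lemma finite_basis_within:
  assumes "subspace A" "A \<subseteq> span B" "finite B"
  obtains C where "C \<subseteq> A" "independent C" "span C = A" "finite C" "card C = dim A"
proof -
  obtain C where C: "C \<subseteq> A" "independent C" "A \<subseteq> span C" "card C = dim A"
    by (rule basis_exists)
  moreover have "finite C"
    using independent_span_bound[OF assms(3) C(2)] C(1) assms(2) by auto
  moreover have "span C = A"
    using C assms(1) by (metis span_minimal subset_antisym)
  ultimately show thesis by (intro that)
qed

text \<open>A basis of \<open>A\<close> extends to one of \<open>C\<close> and has to grow, since it
  spans only \<open>A\<close>.\<close>

lemma dim_less_of_psubset: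
  assumes "subspace A" "subspace C" "A \<subset> C" "C \<subseteq> span B" "finite B"
  shows "dim A < dim C"
proof -
  obtain K where K: "K \<subseteq> A" "independent K" "span K = A" "finite K" "card K = dim A"
    using finite_basis_within[of A B] assms by blast
  obtain L where L: "K \<subseteq> L" "L \<subseteq> C" "independent L" "C \<subseteq> span L"
    using maximal_independent_subset_extend[of K C] K assms(3) by blast
  have "finite L"
    using independent_span_bound[OF assms(5) L(3)] L(2) assms(4) by auto
  moreover have "K \<noteq> L"
    using K(3) L(4) assms(3) by auto
  ultimately have "card K < card L"
    using L(1) by (meson psubsetI psubset_card_mono)
  moreover have "card L = dim C"
    using L by (intro basis_card_eq_dim)
  ultimately show ?thesis
    using K(5) by simp
qed

lemma subspace_eqI_dim:
  assumes "subspace A" "subspace C" "A \<subseteq> C" "C \<subseteq> span B" "finite B" "dim C \<le> dim A"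
  shows "A = C"
proof (rule ccontr)
  assume "A \<noteq> C"
  with assms(3) have "A \<subset> C" by blast
  with assms show False using dim_less_of_psubset[OF assms(1,2) _ assms(4,5)] by simp
qed

end

locale relative_flags = vector_space scale
  for scale :: "'f::field \<Rightarrow> 'v::ab_group_add \<Rightarrow> 'v" (infixr \<open>*s\<close> 75) +
  fixes V V0 :: "'v set" and e :: 'v
  assumes subspace_V: "subspace V"
    and finite_dim_V: "\<exists>B. finite B \<and> B \<subseteq> V \<and> span B = V"
    and subspace_V0: "subspace V0"
    and V0_subset: "V0 \<subseteq> V"
    and e_in_V0: "e \<in> V0"
    and e_nonzero: "e \<noteq> 0"
begin

definition flag_poset :: "'v set set" where
  "flag_poset = Pposet scale V V0"

definition flag_poset_e :: "'v set set" where
  "flag_poset_e = {W \<in> flag_poset. e \<in> W}"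

text \<open>The complements in \<open>V\<close> of the line of \<open>e\<close>; they serve as
  apexes of the cones.\<close>

definition hyperplane :: "'v set \<Rightarrow> bool" where
  "hyperplane H \<longleftrightarrow> subspace H \<and> H \<subseteq> V \<and> e \<notin> H \<and> span (insert e H) = V"

abbreviation plus_e :: "'v set \<Rightarrow> 'v set" where
  "plus_e W \<equiv> span (insert e W)"

lemma e_in_V: "e \<in> V"
  using e_in_V0 V0_subset by blast

lemma flag_poset_iff:
  "W \<in> flag_poset \<longleftrightarrow> subspace W \<and> W \<subseteq> V \<and> W \<noteq> V \<and> (\<forall>v\<in>V. \<exists>w\<in>W. v - w \<in> V0)"
proof -
  have "subspace_sum W V0 = V \<longleftrightarrow> (\<forall>v\<in>V. \<exists>w\<in>W. v - w \<in> V0)" if W: "W \<subseteq> V"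
  proof
    assume eq: "subspace_sum W V0 = V"
    show "\<forall>v\<in>V. \<exists>w\<in>W. v - w \<in> V0"
    proof
      fix v assume "v \<in> V"
      then obtain w u where "w \<in> W" "u \<in> V0" "v = w + u"
        using eq unfolding subspace_sum_def by blast
      then show "\<exists>w\<in>W. v - w \<in> V0" by (auto intro!: bexI[of _ w])
    qed
  next
    assume *: "\<forall>v\<in>V. \<exists>w\<in>W. v - w \<in> V0"
    show "subspace_sum W V0 = V"
    proof
      show "subspace_sum W V0 \<subseteq> V"
        using W V0_subset subspace_add[OF subspace_V] unfolding subspace_sum_def by blast
      show "V \<subseteq> subspace_sum W V0"
      proof
        fix v assume "v \<in> V"
        with * obtain w where "w \<in> W" "v - w \<in> V0" by blast
        then show "v \<in> subspace_sum W V0"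
          unfolding subspace_sum_def mem_Collect_eq
          by (intro exI[of _ w] exI[of _ "v - w"]) simp
      qed
    qed
  qed
  then show ?thesis
    unfolding flag_poset_def Pposet_def by blast
qed

lemma flag_poset_subspace: "W \<in> flag_poset \<Longrightarrow> subspace W"
  and flag_poset_subset: "W \<in> flag_poset \<Longrightarrow> W \<subseteq> V"
  and flag_poset_neq: "W \<in> flag_poset \<Longrightarrow> W \<noteq> V"
  by (simp_all add: flag_poset_iff)

lemma flag_poset_upward:
  "W \<in> flag_poset \<Longrightarrow> W \<subseteq> W' \<Longrightarrow> subspace W' \<Longrightarrow> W' \<subseteq> V \<Longrightarrow> W' \<noteq> V \<Longrightarrow> W' \<in> flag_poset"
  unfolding flag_poset_iff by blast

lemma plus_e_mem: "e \<in> plus_e W" and plus_e_superset: "W \<subseteq> plus_e W"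
  by (auto intro: span_base)

lemma plus_e_subset: "subspace W \<Longrightarrow> A \<subseteq> W \<Longrightarrow> e \<in> W \<Longrightarrow> plus_e A \<subseteq> W"
  by (intro span_minimal) auto

lemma hyperplane_decomp:
  assumes "hyperplane H" "v \<in> V"
  obtains k where "v - k *s e \<in> H"
  using assms in_span_insert_iff[of H v e] by (auto simp: hyperplane_def)

text \<open>Subtracting a multiple of \<open>e\<close> moves a vector of \<open>W\<close> into
  \<open>H\<close> without leaving \<open>W\<close>. Together with \<open>Int_plus_e\<close> this
  gives mutually inverse maps between the subspaces of \<open>V\<close> through \<open>e\<close> and
  the subspaces of \<open>H\<close>.\<close>

lemma plus_e_Int:
  assumes H: "hyperplane H" and W: "subspace W" "W \<subseteq> V" "e \<in> W"
  shows "plus_e (W \<inter> H) = W"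
proof
  show "plus_e (W \<inter> H) \<subseteq> W"
    using W by (intro plus_e_subset) auto
  show "W \<subseteq> plus_e (W \<inter> H)"
  proof
    fix v assume v: "v \<in> W"
    with W obtain k where "v - k *s e \<in> H"
      using hyperplane_decomp[OF H] by blast
    with v W have "v - k *s e \<in> W \<inter> H"
      by (auto intro: subspace_diff subspace_scale)
    moreover have "subspace (W \<inter> H)"
      using H W by (auto simp: hyperplane_def intro: subspace_inter)
    ultimately show "v \<in> plus_e (W \<inter> H)"
      by (auto simp: in_span_insert_iff)
  qed
qed

lemma Int_plus_e:
  assumes H: "hyperplane H" and W: "subspace W" "W \<subseteq> H"
  shows "plus_e W \<inter> H = W"
proof
  show "W \<subseteq> plus_e W \<inter> H"
    using W plus_e_superset by blast
  show "plus_e W \<inter> H \<subseteq> W"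
  proof
    fix v assume v: "v \<in> plus_e W \<inter> H"
    then obtain k where k: "v - k *s e \<in> W"
      using W by (auto simp: in_span_insert_iff)
    have sH: "subspace H" "e \<notin> H" using H by (auto simp: hyperplane_def)
    have "k *s e \<in> H"
      using v k W sH by (auto intro: subspace_diffD[of H v "k *s e"])
    have "k = 0"
    proof (rule ccontr)
      assume "k \<noteq> 0"
      then have "inverse k *s (k *s e) = e" by simp
      with \<open>k *s e \<in> H\<close> sH show False by (metis subspace_scale)
    qed
    with k show "v \<in> W" by simp
  qed
qed

text \<open>A strictly larger \<open>W\<close> would contain a nonzero multiple of \<open>e\<close>,
  hence all of \<open>V\<close>.\<close>

lemma hyperplane_maximal:
  assumes H: "hyperplane H" and W: "W \<in> flag_poset" "H \<subseteq> W"
  shows "W = H"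
proof (rule ccontr)
  assume "W \<noteq> H"
  then obtain v where v: "v \<in> W" "v \<notin> H" using W by blast
  have sW: "subspace W" "W \<subseteq> V" using W flag_poset_iff by auto
  then obtain k where k: "v - k *s e \<in> H" using v hyperplane_decomp[OF H] by blast
  then have "k \<noteq> 0" using v by auto
  have "k *s e \<in> W"
    using sW v k W by (auto intro: subspace_diffD[of W v "k *s e"])
  then have "inverse k *s (k *s e) \<in> W"
    using sW(1) by (rule subspace_scale[rotated])
  then have "e \<in> W" using \<open>k \<noteq> 0\<close> by simp
  then have "plus_e H \<subseteq> W" using W sW by (intro plus_e_subset) auto
  then have "W = V" using H sW by (auto simp: hyperplane_def)
  with W show False by (simp add: flag_poset_iff)
qed

lemma hyperplane_in_flag_poset:
  assumes H: "hyperplane H"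
  shows "H \<in> flag_poset"
proof -
  have "\<exists>w\<in>H. v - w \<in> V0" if "v \<in> V" for v
  proof -
    obtain k where "v - k *s e \<in> H" using hyperplane_decomp[OF H \<open>v \<in> V\<close>] .
    then show ?thesis
      using e_in_V0 subspace_V0 by (intro bexI[of _ "v - k *s e"]) (auto intro: subspace_scale)
  qed
  then show ?thesis
    using H e_in_V by (auto simp: flag_poset_iff hyperplane_def)
qed

text \<open>Here it matters that \<open>e\<close> lies in \<open>V0\<close>: moving \<open>w\<close>
  into \<open>H\<close> along \<open>e\<close> changes \<open>v - w\<close> only by an element of
  \<open>V0\<close>.\<close>

lemma Int_in_flag_poset:
  assumes H: "hyperplane H" and W: "W \<in> flag_poset_e"
  shows "W \<inter> H \<in> flag_poset"
proof -
  have W': "subspace W" "W \<subseteq> V" "e \<in> W" "W \<in> flag_poset"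
    using W by (auto simp: flag_poset_e_def flag_poset_iff)
  have "\<exists>w\<in>W \<inter> H. v - w \<in> V0" if v: "v \<in> V" for v
  proof -
    obtain w where w: "w \<in> W" "v - w \<in> V0" using W' v flag_poset_iff by blast
    then obtain k where k: "w - k *s e \<in> H" using hyperplane_decomp[OF H] W' by blast
    have "(v - w) + k *s e \<in> V0"
      using w e_in_V0 subspace_V0 by (intro subspace_add subspace_scale)
    then have "v - (w - k *s e) \<in> V0" by (simp add: algebra_simps)
    moreover have "w - k *s e \<in> W \<inter> H"
      using w k W' by (auto intro: subspace_diff subspace_scale)
    ultimately show ?thesis by blast
  qed
  then show ?thesis
    using H W' e_in_V by (auto simp: flag_poset_iff hyperplane_def intro: subspace_inter)
qed

text \<open>For properness: if \<open>plus_e W\<close> were \<open>V\<close>, intersecting with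
  \<open>H\<close> would give \<open>W = H\<close>.\<close>

lemma plus_e_in_flag_poset_e:
  assumes H: "hyperplane H" and W: "W \<in> flag_poset" "W \<subset> H"
  shows "plus_e W \<in> flag_poset_e"
proof -
  have "plus_e W \<subseteq> V"
    using W subspace_V e_in_V by (intro plus_e_subset) (auto simp: flag_poset_iff)
  moreover have "plus_e W \<noteq> V"
    using Int_plus_e[OF H, of W] W H by (auto simp: flag_poset_iff hyperplane_def)
  ultimately have "plus_e W \<in> flag_poset"
    using flag_poset_upward[OF W(1) plus_e_superset] by simp
  then show ?thesis
    by (simp add: flag_poset_e_def plus_e_mem)
qed

section \<open>Top-dimensional flags\<close>

lemma V_spanned:
  obtains D where "finite D" "span D = V"
  using finite_dim_V by metis

lemma dim_flag_less:
  assumes "A \<in> flag_poset" "subspace C" "C \<subseteq> V" "A \<subset> C"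
  shows "dim A < dim C"
proof -
  obtain D where "finite D" "span D = V" by (rule V_spanned)
  with assms show ?thesis
    by (intro dim_less_of_psubset[of A C D]) (simp_all add: flag_poset_subspace)
qed

lemma V_subset_span:
  assumes W: "W \<in> flag_poset" and B: "span B = W" and C: "V0 \<subseteq> span (B \<union> C)"
  shows "V \<subseteq> span (B \<union> C)"
proof
  fix v assume "v \<in> V"
  then obtain w where "w \<in> W" "v - w \<in> V0" using W flag_poset_iff by blast
  moreover have "W \<subseteq> span (B \<union> C)" using B span_mono[of B "B \<union> C"] by blast
  ultimately have "w + (v - w) \<in> span (B \<union> C)"
    using C by (intro span_add) auto
  then show "v \<in> span (B \<union> C)" by simp
qed

text \<open>Bases of \<open>W\<close> and \<open>V0\<close> together span \<open>V\<close>. If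
  \<open>e\<close> is in \<open>W\<close>, a basis of \<open>V0\<close> through \<open>e\<close> can
  drop \<open>e\<close>, which saves one vector.\<close>

lemma dim_flag_poset_ge:
  assumes W: "W \<in> flag_poset"
  shows "dim V \<le> dim W + dim V0" and "e \<in> W \<Longrightarrow> dim V < dim W + dim V0"
proof -
  obtain D where D: "finite D" "span D = V" by (rule V_spanned)
  obtain B where B: "span B = W" "finite B" "card B = dim W"
    using finite_basis_within[OF flag_poset_subspace[OF W] _ D(1)] flag_poset_subset[OF W] D(2)
    by blast
  have indep: "independent {e}" using e_nonzero by simp
  obtain C where C: "{e} \<subseteq> C" "C \<subseteq> V0" "independent C" "V0 \<subseteq> span C"
    using maximal_independent_subset_extend[of "{e}" V0] e_in_V0 indep by blast
  have finC: "finite C"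
    using independent_span_bound[OF D(1) C(3)] C(2) D(2) V0_subset by auto
  have cardC: "card C = dim V0" using C by (intro basis_card_eq_dim)
  have "V0 \<subseteq> span (B \<union> C)" using C(4) span_mono[of C "B \<union> C"] by blast
  then have "dim V \<le> card (B \<union> C)"
    using V_subset_span[OF W B(1)] B(2) finC by (intro dim_le_card) auto
  then show "dim V \<le> dim W + dim V0"
    using card_Un_le[of B C] B(3) cardC by linarith
  assume e: "e \<in> W"
  have "C \<subseteq> span (B \<union> (C - {e}))"
  proof
    fix c assume "c \<in> C"
    show "c \<in> span (B \<union> (C - {e}))"
    proof (cases "c = e")
      case True
      then show ?thesis using e B(1) span_mono[of B "B \<union> (C - {e})"] by auto
    next
      case False
      with \<open>c \<in> C\<close> show ?thesis by (intro span_base) auto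
    qed
  qed
  then have "V0 \<subseteq> span (B \<union> (C - {e}))"
    using C(4) span_minimal[OF _ subspace_span] by blast
  then have "dim V \<le> card (B \<union> (C - {e}))"
    using V_subset_span[OF W B(1)] B(2) finC by (intro dim_le_card) auto
  also have "\<dots> \<le> card B + card (C - {e})" by (rule card_Un_le)
  also have "\<dots> < card B + card C"
    using C(1) finC by (intro add_strict_left_mono psubset_card_mono) auto
  finally show "dim V < dim W + dim V0"
    using B(3) cardC by simp
qed

lemma simplicesD:
  assumes "s \<in> simplices P k"
  shows "sorted_wrt (\<subset>) s" "set s \<subseteq> P" "length s = k"
  using assms by (auto simp: simplices_def)

text \<open>The dimensions increase strictly from at least \<open>dim V - dim V0\<close> to at most
  \<open>dim V - 1\<close>. With \<open>dim V0\<close> members there is no room for a gap, so each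
  dimension is forced.\<close>

lemma dim_top_flag:
  assumes s: "s \<in> simplices flag_poset (dim V0)" and p: "p < dim V0"
  shows "dim (s ! p) + dim V0 = dim V + p"
proof -
  note s' = simplicesD[OF s]
  have mem: "s ! q \<in> flag_poset" if "q < dim V0" for q
    using subsetD[OF s'(2)] nth_mem[of q s] s'(3) that by simp
  have step: "dim (s ! q) < dim (s ! Suc q)" if "Suc q < dim V0" for q
  proof -
    have "s ! q \<subset> s ! Suc q"
      using sorted_wrt_nth_less[OF s'(1), of q "Suc q"] s'(3) that by simp
    then show ?thesis
      using mem[of q] mem[of "Suc q"] that
      by (intro dim_flag_less) (simp_all add: flag_poset_subspace flag_poset_subset)
  qed
  have low: "q < dim V0 \<Longrightarrow> dim V + q \<le> dim (s ! q) + dim V0" for q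
  proof (induction q)
    case 0
    then show ?case using dim_flag_poset_ge(1)[OF mem[of 0]] by simp
  next
    case (Suc q)
    then show ?case using step[of q] by simp
  qed
  \<comment> \<open>Here \<open>d\<close> counts members down from the largest one, whose dimension
    is at most \<open>dim V - 1\<close>.\<close>
  have high: "d < dim V0 \<Longrightarrow> dim (s ! (dim V0 - Suc d)) + Suc d \<le> dim V" for d
  proof (induction d)
    case 0
    then have "dim (s ! (dim V0 - 1)) < dim V"
      using mem[of "dim V0 - 1"] by (intro dim_flag_less subspace_V) (auto simp: flag_poset_iff)
    then show ?case by simp
  next
    case (Suc d)
    then have "Suc (dim V0 - Suc (Suc d)) = dim V0 - Suc d" by simp
    with step[of "dim V0 - Suc (Suc d)"] Suc show ?case by simp
  qed
  have "dim V0 - Suc (dim V0 - Suc p) = p" using p by simp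
  then show ?thesis
    using low[OF p] high[of "dim V0 - Suc p"] p by simp
qed

text \<open>The deleted position is visible in the face as the dimension that is missing.\<close>

lemma del_nth_top_flag_inj:
  assumes s: "s \<in> simplices flag_poset (dim V0)" and s': "s' \<in> simplices flag_poset (dim V0)"
    and ij: "i < dim V0" "j < dim V0" and eq: "del_nth i s' = del_nth j s"
  shows "i = j"
proof -
  have lt: "\<not> a < b" if "u \<in> simplices flag_poset (dim V0)" "v \<in> simplices flag_poset (dim V0)"
    "b < dim V0" "del_nth a u = del_nth b v" for a b u v
  proof
    assume ab: "a < b"
    have len: "length u = dim V0" "length v = dim V0" using that simplicesD(3) by blast+
    have "del_nth a u ! a = u ! Suc a" "del_nth b v ! a = v ! a"
      using ab len that(3) by (simp_all add: del_nth_def nth_append)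
    then have "u ! Suc a = v ! a" using that by simp
    then show False
      using dim_top_flag[OF that(1), of "Suc a"] dim_top_flag[OF that(2), of a] ab that(3) by simp
  qed
  show ?thesis
    using lt[OF s' s ij(2) eq] lt[OF s s' ij(1) eq[symmetric]] by simp
qed

text \<open>The largest member has dimension \<open>dim V - 1\<close>, so adjoining a vector outside
  it fills \<open>V\<close>.\<close>

lemma hyperplane_last_top_flag:
  assumes s: "s \<in> simplices flag_poset (dim V0)" and ne: "s \<noteq> []" and e: "e \<notin> last s"
  shows "hyperplane (last s)"
proof -
  obtain D where D: "finite D" "span D = V" by (rule V_spanned)
  have len: "length s = dim V0" and mem: "last s \<in> flag_poset"
    using simplicesD[OF s] ne by auto
  have dim: "dim (last s) + 1 = dim V"
  proof -
    have "dim V0 > 0" using ne len by (metis length_greater_0_conv)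
    then show ?thesis
      using dim_top_flag[OF s, of "dim V0 - 1"] ne len by (simp add: last_conv_nth)
  qed
  have sub: "plus_e (last s) \<subseteq> V"
    using mem subspace_V e_in_V by (intro plus_e_subset) (auto simp: flag_poset_iff)
  have "last s \<subset> plus_e (last s)"
    using e plus_e_mem plus_e_superset by blast
  then have "dim (last s) < dim (plus_e (last s))"
    using mem sub by (intro dim_flag_less) auto
  then have "plus_e (last s) = V"
    using sub dim D by (intro subspace_eqI_dim[of _ _ D] subspace_V) auto
  then show ?thesis
    using e mem by (auto simp: hyperplane_def flag_poset_iff)
qed

text \<open>Deleting the first member \<open>W\<close> containing \<open>e\<close> from a top flag leaves a face whose only other
  completions have fewer members containing \<open>e\<close>, because \<open>W\<close> is the previous member plus the line
  of \<open>e\<close>. Hence the coefficients vanish by induction on the number of such members.\<close>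

lemma top_chain_eq_zero:
  assumes w: "Poly_Mapping.keys w \<subseteq> simplices flag_poset (dim V0)"
    and last: "\<And>s. s \<in> Poly_Mapping.keys w \<Longrightarrow> e \<in> last s"
    and bd: "\<And>t. t \<in> Poly_Mapping.keys (frag_bd w) \<Longrightarrow> set t \<subseteq> flag_poset_e"
    and n: "dim V0 > 0"
  shows "w = 0"
proof -
  obtain D where D: "finite D" "span D = V" by (rule V_spanned)
  have "Poly_Mapping.lookup w s = 0" if "s \<in> simplices flag_poset (dim V0)" for s
    using that
  proof (induction "length (filter (\<lambda>W. e \<in> W) s)" arbitrary: s rule: less_induct)
    case less
    note s = less.prems
    note s' = simplicesD[OF s]
    show ?case
    proof (rule ccontr)
      assume nz: "Poly_Mapping.lookup w s \<noteq> 0"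
      then have "e \<in> last s" using last by (simp add: in_keys_iff)
      then have ex: "dim V0 - 1 < dim V0 \<and> e \<in> s ! (dim V0 - 1)"
        using s'(3) n by (metis diff_less last_conv_nth length_0_conv less_one nat_neq_iff)
      define j where "j = (LEAST i. i < dim V0 \<and> e \<in> s ! i)"
      have j: "j < dim V0" "e \<in> s ! j"
        using LeastI[of "\<lambda>i. i < dim V0 \<and> e \<in> s ! i", OF ex] by (auto simp: j_def)
      \<comment> \<open>The smallest member has dimension exactly \<open>dim V - dim V0\<close>,
        while a member through \<open>e\<close> must have a larger one.\<close>
      have "j \<noteq> 0"
      proof
        assume "j = 0"
        then have "dim V < dim (s ! 0) + dim V0"
          using j s' by (intro dim_flag_poset_ge) auto
        then show False using dim_top_flag[OF s, of 0] n by simp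
      qed
      then obtain i where i: "j = Suc i" using not0_implies_Suc by blast
      have ei: "e \<notin> s ! i"
        using not_less_Least[of i "\<lambda>i. i < dim V0 \<and> e \<in> s ! i"] i j by (auto simp: j_def)
      define t where "t = del_nth j s"
      have "s ! i = t ! i" "i < length t"
        using i j s'(3) by (auto simp: t_def del_nth_def nth_append)
      then have "s ! i \<in> set t" by simp
      \<comment> \<open>The face keeps \<open>s ! i\<close>, which misses \<open>e\<close>, whereas
        \<open>bd\<close> only allows flags all of whose members contain \<open>e\<close>.\<close>
      then have "t \<notin> Poly_Mapping.keys (frag_bd w)"
        using bd[of t] ei by (auto simp: flag_poset_e_def)
      then have 0: "(\<Sum>u\<in>Poly_Mapping.keys w.
          Poly_Mapping.lookup w u * Poly_Mapping.lookup (list_bd u) t) = 0"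
        by (simp add: in_keys_iff lookup_frag_extend)
      have other: "Poly_Mapping.lookup (list_bd u) t = 0"
        if u: "u \<in> Poly_Mapping.keys w" "u \<noteq> s" for u
      proof (rule ccontr)
        assume "Poly_Mapping.lookup (list_bd u) t \<noteq> 0"
        then obtain k where k: "k < length u" "del_nth k u = t"
          unfolding lookup_list_bd by (metis (mono_tags, lifting) mem_Collect_eq sum.neutral)
        have us: "u \<in> simplices flag_poset (dim V0)" using u w by blast
        note u' = simplicesD[OF us]
        have "k = j"
          using del_nth_top_flag_inj[OF s us _ j(1)] k u'(3) by (auto simp: t_def)
        then have eq: "take j u = take j s" "drop (Suc j) u = drop (Suc j) s"
          using k j s'(3) u'(3) by (auto simp: t_def del_nth_def)
        have split_u: "u = take j s @ u ! j # drop (Suc j) s"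
          using id_take_nth_drop[of j u] eq j u'(3) by simp
        have split_s: "s = take j s @ s ! j # drop (Suc j) s"
          using id_take_nth_drop[of j s] j s'(3) by simp
        have "u ! i = s ! i"
          using eq(1) i by (metis lessI nth_take)
        have plus: "v ! j = plus_e (v ! i)"
          if v: "v \<in> simplices flag_poset (dim V0)" "e \<in> v ! j" "e \<notin> v ! i" for v
        proof -
          note v' = simplicesD[OF v(1)]
          have mem: "v ! j \<in> flag_poset" "v ! i \<in> flag_poset"
            using subsetD[OF v'(2)] nth_mem[of j v] nth_mem[of i v] v'(3) i j(1) by auto
          have "v ! i \<subset> v ! j" using sorted_wrt_nth_less[OF v'(1), of i j] v'(3) i j(1) by simp
          then have sub: "plus_e (v ! i) \<subseteq> v ! j"
            using v mem by (intro plus_e_subset flag_poset_subspace) auto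
          have Vj: "v ! j \<subseteq> V" using mem flag_poset_subset by blast
          have "v ! i \<subset> plus_e (v ! i)"
            using v(3) plus_e_mem plus_e_superset by blast
          then have "dim (v ! i) < dim (plus_e (v ! i))"
            using mem sub Vj by (intro dim_flag_less) auto
          moreover have "dim (v ! j) = Suc (dim (v ! i))"
            using dim_top_flag[OF v(1), of j] dim_top_flag[OF v(1), of i] i j by simp
          ultimately have "dim (v ! j) \<le> dim (plus_e (v ! i))" by simp
          then show ?thesis
            using sub mem Vj D subspace_eqI_dim[of "plus_e (v ! i)" "v ! j" D]
            by (simp add: flag_poset_subspace)
        qed
        have "e \<notin> u ! j"
        proof
          assume "e \<in> u ! j"
          then have "u ! j = s ! j"
            using plus[OF us] plus[OF s j(2) ei] ei \<open>u ! i = s ! i\<close> by simp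
          then show False using split_u split_s u(2) by simp
        qed
        then have "length (filter (\<lambda>W. e \<in> W) u) < length (filter (\<lambda>W. e \<in> W) s)"
          using j(2) by (subst split_u, subst split_s) simp
        then have "Poly_Mapping.lookup w u = 0" using less.hyps us by blast
        then show False using u by (simp add: in_keys_iff)
      qed
      have "s \<in> Poly_Mapping.keys w" using nz by (simp add: in_keys_iff)
      then have "Poly_Mapping.lookup w s * Poly_Mapping.lookup (list_bd s) t = 0"
        using 0 other by (simp add: sum.remove[of _ s])
      then have "Poly_Mapping.lookup (list_bd s) t = 0" using nz by simp
      \<comment> \<open>Only position \<open>j\<close> produces \<open>t\<close>, so the coefficient
        is a sign and cannot vanish.\<close>
      moreover have "{i. i < length s \<and> del_nth i s = t} = {j}"
        using del_nth_top_flag_inj[OF s s _ j(1)] j s'(3) by (auto simp: t_def)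
      ultimately show False by (simp add: lookup_list_bd)
    qed
  qed
  then show ?thesis
    using w by (intro poly_mapping_eqI) (metis in_keys_iff lookup_zero subsetD)
qed

section \<open>Decomposition of a cycle into cones\<close>

lemma Int_psubset:
  assumes "hyperplane H" "W \<in> flag_poset_e"
  shows "W \<inter> H \<subset> W" and "W \<inter> H \<subset> H"
proof -
  have e: "e \<in> W" "e \<notin> H" "W \<in> flag_poset"
    using assms by (auto simp: hyperplane_def flag_poset_e_def)
  then show "W \<inter> H \<subset> W" by blast
  show "W \<inter> H \<subset> H"
    using hyperplane_maximal[OF assms(1) e(3)] e by blast
qed

lemma plus_e_Int_flag: "hyperplane H \<Longrightarrow> W \<in> flag_poset_e \<Longrightarrow> plus_e (W \<inter> H) = W"
  by (intro plus_e_Int) (auto simp: flag_poset_e_def flag_poset_iff)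

text \<open>Strictness survives because \<open>plus_e\<close> recovers \<open>W\<close> from
  \<open>W \<inter> H\<close>.\<close>

lemma Int_psubset_mono:
  assumes "hyperplane H" "W \<in> flag_poset_e" "W' \<in> flag_poset_e" "W \<subset> W'"
  shows "W \<inter> H \<subset> W' \<inter> H"
proof -
  have "W \<inter> H \<noteq> W' \<inter> H"
  proof
    assume "W \<inter> H = W' \<inter> H"
    then have "plus_e (W \<inter> H) = plus_e (W' \<inter> H)" by (rule arg_cong)
    then have "W = W'" unfolding plus_e_Int_flag[OF assms(1,2)] plus_e_Int_flag[OF assms(1,3)] .
    then show False using assms(4) by blast
  qed
  then show ?thesis using assms(4) by blast
qed

text \<open>The terms are \<open>x1 \<inter> H, ..., xi \<inter> H, xi, ..., xk\<close> and finally
  \<open>x1 \<inter> H, ..., xk \<inter> H, H\<close>. The bound on the members is part of the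
  induction, as it is what compares a new head with the tail.\<close>

lemma keys_flag_cone:
  assumes H: "hyperplane H"
  shows "s \<in> Poly_Mapping.keys (flag_cone H F) \<Longrightarrow> sorted_wrt (\<subset>) F \<Longrightarrow> set F \<subseteq> flag_poset_e \<Longrightarrow>
    sorted_wrt (\<subset>) s \<and> set s \<subseteq> insert H (set F \<union> (\<lambda>x. x \<inter> H) ` set F) \<and>
    length s = Suc (length F)"
proof (induction F arbitrary: s)
  case Nil
  then show ?case by simp
next
  case (Cons x F)
  have x: "x \<in> flag_poset_e" and F: "set F \<subseteq> flag_poset_e" "sorted_wrt (\<subset>) F"
    and less: "\<And>y. y \<in> set F \<Longrightarrow> x \<subset> y"
    using Cons.prems by auto
  note xH = Int_psubset[OF H x]
  have "s = (x \<inter> H) # x # F \<or> (\<exists>u\<in>Poly_Mapping.keys (flag_cone H F). s = (x \<inter> H) # u)"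
    using Cons.prems(1) keys_cons_frag[of "x \<inter> H" "flag_cone H F"] keys_diff
    by (fastforce simp: keys_frag_of)
  then show ?case
  proof
    assume s: "s = (x \<inter> H) # x # F"
    have "x \<inter> H \<subset> y" if "y \<in> set F" for y
      using xH(1) less[OF that] by blast
    then show ?thesis
      using s xH(1) less F by auto
  next
    assume "\<exists>u\<in>Poly_Mapping.keys (flag_cone H F). s = (x \<inter> H) # u"
    then obtain u where u: "u \<in> Poly_Mapping.keys (flag_cone H F)" "s = (x \<inter> H) # u" by blast
    note IH = Cons.IH[OF u(1) F(2,1)]
    have "x \<inter> H \<subset> y" if y_in: "y \<in> set u" for y
    proof -
      consider "y = H" | "y \<in> set F" | z where "z \<in> set F" "y = z \<inter> H"
        using IH y_in by blast
      then show ?thesis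
      proof cases
        case 1
        then show ?thesis using xH by simp
      next
        case 2
        then show ?thesis using xH(1) less by blast
      next
        case 3
        then show ?thesis
          using Int_psubset_mono[OF H x, of z] F less by blast
      qed
    qed
    then show ?thesis
      using IH u(2) by auto
  qed
qed

lemma flag_cone_simplices:
  assumes H: "hyperplane H" and F: "F \<in> simplices flag_poset_e k"
  shows "Poly_Mapping.keys (flag_cone H F) \<subseteq> simplices flag_poset (Suc k)"
proof
  fix s assume s: "s \<in> Poly_Mapping.keys (flag_cone H F)"
  note F' = simplicesD[OF F]
  note K = keys_flag_cone[OF H s F'(1,2)]
  have "set F \<subseteq> flag_poset" using F'(2) by (auto simp: flag_poset_e_def)
  moreover have "(\<lambda>x. x \<inter> H) ` set F \<subseteq> flag_poset"
    using F'(2) Int_in_flag_poset[OF H] by blast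
  ultimately have "insert H (set F \<union> (\<lambda>x. x \<inter> H) ` set F) \<subseteq> flag_poset"
    using hyperplane_in_flag_poset[OF H] by blast
  with K F'(3) show "s \<in> simplices flag_poset (Suc k)"
    by (auto simp: simplices_def)
qed

section \<open>Flags whose largest member avoids \<open>e\<close>\<close>

definition avoids_e :: "'v set list \<Rightarrow> bool" where
  "avoids_e s \<longleftrightarrow> s \<noteq> [] \<and> e \<notin> last s"

abbreviation avoiding_part :: "('v set list \<Rightarrow>\<^sub>0 int) \<Rightarrow> ('v set list \<Rightarrow>\<^sub>0 int)" where
  "avoiding_part \<equiv> frag_extend (\<lambda>s. if avoids_e s then frag_of s else 0)"

lemma avoiding_part_cons_frag:
  assumes "Poly_Mapping.keys c \<subseteq> {s. s \<noteq> []}"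
  shows "avoiding_part (cons_frag x c) = cons_frag x (avoiding_part c)"
  using assms
  by (induction c rule: frag_induction) (auto simp: frag_extend_diff avoids_e_def)

text \<open>Only the final term of the cone ends in \<open>H\<close>; every other term ends in a
  member of \<open>F\<close>, which contains \<open>e\<close>.\<close>

lemma avoiding_part_flag_cone:
  assumes H: "hyperplane H"
  shows "sorted_wrt (\<subset>) F \<Longrightarrow> set F \<subseteq> flag_poset_e \<Longrightarrow>
    avoiding_part (flag_cone H F) =
      frag_cmul ((- 1) ^ length F) (frag_of (map (\<lambda>x. x \<inter> H) F @ [H]))"
proof (induction F)
  case Nil
  show ?case using H by (simp add: avoids_e_def hyperplane_def)
next
  case (Cons x F)
  have "\<not> avoids_e ((x \<inter> H) # x # F)"
    using Cons.prems last_in_set[of "x # F"] by (auto simp: avoids_e_def flag_poset_e_def split: if_splits)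
  moreover have "Poly_Mapping.keys (flag_cone H F) \<subseteq> {s. s \<noteq> []}"
    using keys_flag_cone[OF H, of _ F] Cons.prems by fastforce
  ultimately show ?case
    using Cons by (simp add: frag_extend_diff avoiding_part_cons_frag frag_extend_cmul)
qed

text \<open>For a hyperplane \<open>H\<close> this is the residue of a flag at its maximal member \<open>H\<close>; adding the line
  of \<open>e\<close> identifies the subspaces below \<open>H\<close> with those containing \<open>e\<close>.\<close>

definition residue :: "'v set \<Rightarrow> 'v set list \<Rightarrow> ('v set list \<Rightarrow>\<^sub>0 int)" where
  "residue H s = (if s \<noteq> [] \<and> last s = H then frag_of (map plus_e (butlast s)) else 0)"

text \<open>Faces that keep the last member correspond directly. The face without it has residue
  zero, since otherwise \<open>H\<close> would lie strictly below a member of the poset. Thus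
  residues of cycles are cycles.\<close>

lemma frag_bd_residue:
  assumes H: "hyperplane H" and s: "s \<in> simplices flag_poset k"
  shows "frag_bd (residue H s) = frag_extend (residue H) (list_bd s)"
proof (cases s rule: rev_cases)
  case Nil
  then show ?thesis by (simp add: residue_def)
next
  case (snoc u x)
  have x: "x \<in> flag_poset" and less: "\<And>y. y \<in> set u \<Longrightarrow> y \<subset> x"
    using simplicesD[OF s] snoc by (auto simp: sorted_wrt_append)
  have "residue H u = 0"
  proof (rule ccontr)
    assume "residue H u \<noteq> 0"
    then have "u \<noteq> []" "last u = H" by (auto simp: residue_def split: if_splits)
    then have "H \<subset> x" using less[of "last u"] last_in_set by blast
    then show False using hyperplane_maximal[OF H x] by blast
  qed
  then have "frag_extend (residue H) (list_bd s) =
      frag_extend (\<lambda>v. residue H (v @ [x])) (list_bd u)"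
    by (simp add: snoc list_bd_snoc frag_extend_add frag_extend_cmul frag_extend_comp)
  also have "\<dots> = frag_bd (residue H s)"
  proof (cases "x = H")
    case True
    then show ?thesis by (simp add: residue_def snoc list_bd_map)
  next
    case False
    then show ?thesis by (simp add: residue_def snoc frag_extend_eq_0)
  qed
  finally show ?thesis by simp
qed

text \<open>The images under \<open>plus_e\<close> stay distinct because intersecting with
  \<open>H\<close> gives the original members back.\<close>

lemma residue_simplices:
  assumes H: "hyperplane H" and s: "s \<in> simplices flag_poset (Suc k)"
  shows "Poly_Mapping.keys (residue H s) \<subseteq> simplices flag_poset_e k"
proof (cases "last s = H")
  case True
  note s' = simplicesD[OF s]
  have ne: "s \<noteq> []" using s' by auto
  define u where "u = butlast s"
  have su: "s = u @ [H]" using ne True by (metis append_butlast_last_id u_def)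
  have u: "sorted_wrt (\<subset>) u" "length u = k" "\<And>W. W \<in> set u \<Longrightarrow> W \<in> flag_poset \<and> W \<subset> H"
    using s' su by (auto simp: sorted_wrt_append)
  have "sorted_wrt (\<lambda>x y. plus_e x \<subset> plus_e y) u"
  proof (rule sorted_wrt_mono_rel[OF _ u(1)])
    fix x y assume xy: "x \<in> set u" "y \<in> set u" "x \<subset> y"
    have "plus_e x \<inter> H = x" "plus_e y \<inter> H = y"
      using u(3) xy by (auto intro!: Int_plus_e[OF H] flag_poset_subspace)
    moreover have "plus_e x \<subseteq> plus_e y" using xy by (intro span_mono) auto
    ultimately show "plus_e x \<subset> plus_e y" using xy(3) by blast
  qed
  moreover have "plus_e ` set u \<subseteq> flag_poset_e"
    using plus_e_in_flag_poset_e[OF H] u(3) by blast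
  ultimately have "map plus_e u \<in> simplices flag_poset_e k"
    using u(2) by (simp add: simplices_def sorted_wrt_map)
  then show ?thesis by (simp add: residue_def u_def)
next
  case False
  then show ?thesis by (simp add: residue_def)
qed

text \<open>Adding \<open>e\<close> and then intersecting with \<open>H\<close> is the identity
  below \<open>H\<close>, so the one avoiding term of the cone is \<open>s\<close> itself, up to
  sign.\<close>

lemma avoiding_part_cone_residue:
  assumes H: "hyperplane H" and s: "s \<in> simplices flag_poset (Suc m)"
  shows "avoiding_part (frag_extend (flag_cone H) (residue H s)) =
    (if last s = H then frag_cmul ((- 1) ^ m) (frag_of s) else 0)"
proof (cases "last s = H")
  case True
  note s' = simplicesD[OF s]
  have ne: "s \<noteq> []" using s' by auto
  define u where "u = butlast s"
  have su: "s = u @ [H]" using ne True by (metis append_butlast_last_id u_def)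
  have u: "\<And>W. W \<in> set u \<Longrightarrow> W \<in> flag_poset \<and> W \<subset> H" "length u = m"
    using s' su by (auto simp: sorted_wrt_append)
  have res: "residue H s = frag_of (map plus_e u)"
    using ne True by (simp add: residue_def u_def)
  then have "map plus_e u \<in> simplices flag_poset_e m"
    using residue_simplices[OF H s] by simp
  note F = simplicesD[OF this]
  have "plus_e W \<inter> H = W" if "W \<in> set u" for W
    using u(1)[OF that] by (intro Int_plus_e[OF H]) (auto simp: flag_poset_subspace)
  then have "map (\<lambda>x. x \<inter> H) (map plus_e u) = u"
    by (simp add: map_idI)
  then show ?thesis
    using avoiding_part_flag_cone[OF H F(1,2)] True res su u(2) by simp
next
  case False
  then show ?thesis by (simp add: residue_def)
qed

lemma cycle_eq_sum_cones:
  assumes z: "Poly_Mapping.keys z \<subseteq> simplices flag_poset (dim V0)" "frag_bd z = 0"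
    and n: "dim V0 = Suc m"
  obtains S y where "finite S" "\<And>H. H \<in> S \<Longrightarrow> hyperplane H"
    and "\<And>H. H \<in> S \<Longrightarrow> Poly_Mapping.keys (y H) \<subseteq> simplices flag_poset_e m"
    and "\<And>H. H \<in> S \<Longrightarrow> frag_bd (y H) = 0"
    and "z = (\<Sum>H\<in>S. frag_extend (flag_cone H) (y H))"
proof -
  define S where "S = last ` {s \<in> Poly_Mapping.keys z. avoids_e s}"
  \<comment> \<open>The sign cancels the one in \<open>avoiding_part_cone_residue\<close>.\<close>
  define y where "y H = frag_cmul ((- 1) ^ m) (frag_extend (residue H) z)" for H
  define w where "w = z - (\<Sum>H\<in>S. frag_extend (flag_cone H) (y H))"
  have fin: "finite S" by (simp add: S_def)
  have hyp: "hyperplane H" if "H \<in> S" for H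
    using that z(1) by (auto simp: S_def avoids_e_def intro!: hyperplane_last_top_flag)
  have keys_y: "Poly_Mapping.keys (y H) \<subseteq> simplices flag_poset_e m" if "H \<in> S" for H
  proof -
    have "Poly_Mapping.keys (frag_extend (residue H) z) \<subseteq> simplices flag_poset_e m"
      using z(1) n residue_simplices[OF hyp[OF that]] by (intro keys_frag_extend_subset) auto
    then show ?thesis using keys_cmul unfolding y_def by blast
  qed
  have bd_y: "frag_bd (y H) = 0" if "H \<in> S" for H
  proof -
    have "frag_bd (frag_extend (residue H) z) = frag_extend (\<lambda>s. frag_extend (residue H) (list_bd s)) z"
      unfolding frag_extend_comp
      by (intro frag_extend_cong_on[OF z(1)] frag_bd_residue[OF hyp[OF that]])
    also have "\<dots> = frag_extend (residue H) (frag_bd z)"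
      by (simp add: frag_extend_comp)
    finally show ?thesis
      using z(2) by (simp add: y_def frag_extend_cmul)
  qed
  have keys_cone: "Poly_Mapping.keys (frag_extend (flag_cone H) (y H)) \<subseteq> simplices flag_poset (dim V0)"
    if "H \<in> S" for H
    unfolding n using keys_y[OF that] flag_cone_simplices[OF hyp[OF that]]
    by (intro keys_frag_extend_subset) auto
  have w_keys: "Poly_Mapping.keys w \<subseteq> simplices flag_poset (dim V0)"
    unfolding w_def
    using z(1) keys_cone keys_sum[of "\<lambda>H. frag_extend (flag_cone H) (y H)" S]
    by (intro keys_frag_diff_subset) blast+
  \<comment> \<open>Each cone has boundary \<open>y H\<close>, so the boundary of \<open>w\<close>
    is supported on flags through \<open>e\<close>.\<close>
  have w_bd: "frag_bd w = - (\<Sum>H\<in>S. y H)"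
    using z(2) bd_y by (simp add: w_def frag_extend_diff frag_extend_sum[OF fin] comp_def
        frag_bd_extend_flag_cone)
  \<comment> \<open>Every avoiding flag of \<open>z\<close> ends in exactly one \<open>H\<close> of
    \<open>S\<close>, and the cone over that \<open>H\<close> removes it.\<close>
  have "avoiding_part w = 0"
  proof -
    have "avoiding_part (\<Sum>H\<in>S. frag_extend (flag_cone H) (y H)) =
        (\<Sum>H\<in>S. frag_cmul ((- 1) ^ m)
          (frag_extend (\<lambda>s. avoiding_part (frag_extend (flag_cone H) (residue H s))) z))"
      by (simp add: frag_extend_sum[OF fin] comp_def y_def frag_extend_cmul frag_extend_comp)
    also have "\<dots> = (\<Sum>H\<in>S. frag_extend (\<lambda>s. if last s = H then frag_of s else 0) z)"
    proof (rule sum.cong[OF refl])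
      fix H assume "H \<in> S"
      then have "frag_extend (\<lambda>s. avoiding_part (frag_extend (flag_cone H) (residue H s))) z =
          frag_extend (\<lambda>s. frag_cmul ((- 1) ^ m) (if last s = H then frag_of s else 0)) z"
        using avoiding_part_cone_residue[OF hyp] n
        by (intro frag_extend_cong_on[OF z(1)]) auto
      then show "frag_cmul ((- 1) ^ m)
          (frag_extend (\<lambda>s. avoiding_part (frag_extend (flag_cone H) (residue H s))) z) =
          frag_extend (\<lambda>s. if last s = H then frag_of s else 0) z"
        by (simp add: frag_extend_map_cmul power_mult_distrib[symmetric])
    qed
    also have "\<dots> = frag_extend (\<lambda>s. \<Sum>H\<in>S. if last s = H then frag_of s else 0) z"
      by (simp add: frag_extend_map_sum[OF fin])
    also have "\<dots> = avoiding_part z"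
    proof (rule frag_extend_eq)
      fix s assume s: "s \<in> Poly_Mapping.keys z"
      then have "s \<noteq> []" using z(1) n by (auto simp: simplices_def)
      then have "last s \<in> S \<longleftrightarrow> avoids_e s"
        using s by (auto simp: S_def avoids_e_def)
      then show "(\<Sum>H\<in>S. if last s = H then frag_of s else 0) = (if avoids_e s then frag_of s else 0)"
        using fin by simp
    qed
    finally show ?thesis
      by (simp add: w_def frag_extend_diff)
  qed
  then have w_last: "e \<in> last s" if "s \<in> Poly_Mapping.keys w" for s
    using that lookup_frag_filter[of avoids_e w s] w_keys n
    by (auto simp: avoids_e_def in_keys_iff simplices_def split: if_splits)
  have "w = 0"
  proof (rule top_chain_eq_zero[OF w_keys w_last])
    fix t assume "t \<in> Poly_Mapping.keys (frag_bd w)"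
    then have "t \<in> simplices flag_poset_e m"
      using keys_y keys_sum[of y S] unfolding w_bd keys_minus by blast
    then show "set t \<subseteq> flag_poset_e" by (simp add: simplices_def)
  qed (use n in auto)
  then show thesis
    using that[OF fin hyp keys_y bd_y] by (simp add: w_def)
qed

section \<open>Transvections and dilations along the line\<close>

definition functional :: "('v \<Rightarrow> 'f) \<Rightarrow> bool" where
  "functional \<phi> \<longleftrightarrow> (\<forall>x y. \<phi> (x + y) = \<phi> x + \<phi> y) \<and> (\<forall>c x. \<phi> (c *s x) = c * \<phi> x)"

text \<open>A transvection if \<open>\<phi> e = 0\<close>, otherwise a dilation. It multiplies
  \<open>e\<close> by \<open>1 + \<phi> e\<close>, so it is invertible exactly when this scalar is
  nonzero.\<close>

definition shear :: "('v \<Rightarrow> 'f) \<Rightarrow> 'v \<Rightarrow> 'v" where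
  "shear \<phi> v = v + \<phi> v *s e"

definition ker_V :: "('v \<Rightarrow> 'f) \<Rightarrow> 'v set" where
  "ker_V \<psi> = {v \<in> V. \<psi> v = 0}"

lemma functionalD:
  assumes "functional \<phi>"
  shows "\<phi> (x + y) = \<phi> x + \<phi> y" "\<phi> (c *s x) = c * \<phi> x" "\<phi> 0 = 0" "\<phi> (x - y) = \<phi> x - \<phi> y"
proof -
  show add: "\<phi> (x + y) = \<phi> x + \<phi> y" for x y using assms by (simp add: functional_def)
  show "\<phi> (c *s x) = c * \<phi> x" using assms by (simp add: functional_def)
  have "\<phi> (0 *s 0) = 0 * \<phi> 0" using assms unfolding functional_def by blast
  then show "\<phi> 0 = 0" by simp
  show "\<phi> (x - y) = \<phi> x - \<phi> y" using add[of "x - y" y] by (simp add: algebra_simps)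
qed

lemma functional_comb:
  "functional \<phi> \<Longrightarrow> functional \<psi> \<Longrightarrow> functional (\<lambda>v. a * \<phi> v + b * \<psi> v)"
  by (simp add: functional_def algebra_simps)

lemma inj_shear:
  assumes \<phi>: "functional \<phi>" "1 + \<phi> e \<noteq> 0"
  shows "inj (shear \<phi>)"
proof (rule injI)
  fix v w assume eq: "shear \<phi> v = shear \<phi> w"
  then have "\<phi> (shear \<phi> v) = \<phi> (shear \<phi> w)" by simp
  then have "(1 + \<phi> e) * \<phi> v = (1 + \<phi> e) * \<phi> w"
    by (simp add: shear_def functionalD[OF \<phi>(1)] algebra_simps)
  then have "\<phi> v = \<phi> w" using \<phi>(2) by simp
  with eq show "v = w" by (simp add: shear_def)
qed

lemma shear_image:
  assumes \<phi>: "functional \<phi>" "1 + \<phi> e \<noteq> 0" and W: "subspace W" "e \<in> W"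
  shows "shear \<phi> ` W = W"
proof
  show "shear \<phi> ` W \<subseteq> W"
    using W by (auto simp: shear_def intro: subspace_add subspace_scale)
  show "W \<subseteq> shear \<phi> ` W"
  proof
    fix w assume w: "w \<in> W"
    \<comment> \<open>The inverse shear: applying \<open>\<phi>\<close> to
      \<open>shear \<phi> v = w\<close> forces
      \<open>\<phi> v = \<phi> w / (1 + \<phi> e)\<close>.\<close>
    define v where "v = w - (\<phi> w / (1 + \<phi> e)) *s e"
    have "v \<in> W" using w W by (auto simp: v_def intro: subspace_diff subspace_scale)
    moreover have "\<phi> v = \<phi> w / (1 + \<phi> e)"
      using \<phi>(2) by (simp add: v_def functionalD[OF \<phi>(1)] field_simps)
    then have "shear \<phi> v = w" by (simp add: shear_def v_def)
    ultimately show "w \<in> shear \<phi> ` W" by blast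
  qed
qed

lemma shear_in_AT:
  assumes \<phi>: "functional \<phi>" "1 + \<phi> e \<noteq> 0"
  shows "shear \<phi> \<in> AT scale V V0"
proof -
  have "Vector_Spaces.linear scale scale (shear \<phi>)"
    unfolding Vector_Spaces.linear_iff
    using vector_space_axioms functionalD[OF \<phi>(1)]
    by (simp add: shear_def scale_left_distrib scale_right_distrib)
  moreover have "bij_betw (shear \<phi>) V V"
    using inj_shear[OF \<phi>] shear_image[OF \<phi> subspace_V e_in_V]
    by (auto simp: bij_betw_def intro: inj_on_subset)
  moreover have "shear \<phi> v - v \<in> V0" for v
    using e_in_V0 subspace_V0 by (simp add: shear_def subspace_scale)
  ultimately show ?thesis
    using shear_image[OF \<phi> subspace_V0 e_in_V0] by (simp add: AT_def)
qed

text \<open>The factor \<open>c\<close> leaves room to renormalise the transported functional to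
  value \<open>1\<close> at \<open>e\<close>.\<close>

lemma shear_ker_V:
  assumes \<phi>: "functional \<phi>" "1 + \<phi> e \<noteq> 0"
    and c: "c \<noteq> 0" "\<And>v. \<psi>' (shear \<phi> v) = c * \<psi> v"
  shows "shear \<phi> ` ker_V \<psi> = ker_V \<psi>'"
proof -
  have "shear \<phi> ` V = V" using shear_image[OF \<phi> subspace_V e_in_V] .
  then show ?thesis using c by (force simp: ker_V_def)
qed

lemma hyperplane_ker_V:
  assumes \<psi>: "functional \<psi>" "\<psi> e = 1"
  shows "hyperplane (ker_V \<psi>)"
proof -
  have sub: "subspace (ker_V \<psi>)"
    using subspace_V
    by (auto simp: subspace_def ker_V_def functionalD[OF \<psi>(1)])
  have "plus_e (ker_V \<psi>) \<subseteq> V"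
    using subspace_V e_in_V by (intro plus_e_subset) (auto simp: ker_V_def)
  moreover have "v \<in> plus_e (ker_V \<psi>)" if "v \<in> V" for v
  proof -
    have "v - \<psi> v *s e \<in> ker_V \<psi>"
      using that \<psi>(2) subspace_V e_in_V
      by (auto simp: ker_V_def functionalD[OF \<psi>(1)] intro: subspace_diff subspace_scale)
    then show ?thesis using in_span_insert_iff[OF sub] by blast
  qed
  ultimately show ?thesis
    using sub \<psi>(2) by (auto simp: hyperplane_def ker_V_def)
qed

text \<open>A basis of \<open>H\<close> together with \<open>e\<close> is independent, so the values
  \<open>0\<close> on the basis and \<open>1\<close> at \<open>e\<close> extend linearly.\<close>

lemma hyperplane_functional:
  assumes H: "hyperplane H"
  obtains \<psi> where "functional \<psi>" "\<psi> e = 1" "H = ker_V \<psi>"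
proof -
  interpret vector_space_pair scale "(*) :: 'f \<Rightarrow> 'f \<Rightarrow> 'f"
    by unfold_locales (auto simp: algebra_simps)
  have sH: "subspace H" "H \<subseteq> V" "e \<notin> H" using H by (auto simp: hyperplane_def)
  obtain D where D: "finite D" "span D = V" by (rule V_spanned)
  obtain B where B: "independent B" "span B = H"
    using finite_basis_within[OF sH(1) _ D(1)] sH(2) D(2) by blast
  have "independent (insert e B)"
    using B sH(3) by (intro independent_insertI) auto
  then obtain \<psi> where \<psi>: "Vector_Spaces.linear scale (*) \<psi>"
    "\<forall>x\<in>insert e B. \<psi> x = (if x = e then 1 else 0)"
    using linear_independent_extend[of "insert e B" "\<lambda>x. if x = e then 1 else 0"] by blast
  have fun_\<psi>: "functional \<psi>"
    using \<psi>(1) by (simp add: Vector_Spaces.linear_iff functional_def)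
  have e1: "\<psi> e = 1" using \<psi>(2) by simp
  have "subspace {x. \<psi> x = 0}"
    by (auto simp: subspace_def functionalD[OF fun_\<psi>])
  moreover have "e \<notin> B" using B(2) sH(3) span_base by blast
  then have "B \<subseteq> {x. \<psi> x = 0}" using \<psi>(2) by auto
  ultimately have ker: "H \<subseteq> {x. \<psi> x = 0}"
    using span_minimal B(2) by blast
  have "H = ker_V \<psi>"
  proof
    show "H \<subseteq> ker_V \<psi>" using ker sH(2) by (auto simp: ker_V_def)
    show "ker_V \<psi> \<subseteq> H"
    proof
      fix x assume "x \<in> ker_V \<psi>"
      then have x: "x \<in> V" "\<psi> x = 0" by (auto simp: ker_V_def)
      obtain k where k: "x - k *s e \<in> H" using hyperplane_decomp[OF H x(1)] .
      then have "\<psi> (x - k *s e) = 0" using ker by blast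
      then have "k = 0" using x(2) e1 by (simp add: functionalD[OF fun_\<psi>])
      with k show "x \<in> H" by simp
    qed
  qed
  with fun_\<psi> e1 show thesis by (rule that)
qed

text \<open>A shear fixes every subspace through \<open>e\<close>, so in the cone only the apex
  moves.\<close>

lemma map_shear_flag_cone:
  assumes \<phi>: "functional \<phi>" "1 + \<phi> e \<noteq> 0"
  shows "set F \<subseteq> flag_poset_e \<Longrightarrow>
    frag_extend (\<lambda>s. frag_of (map ((`) (shear \<phi>)) s)) (flag_cone H F) = flag_cone (shear \<phi> ` H) F"
proof (induction F)
  case Nil
  show ?case by simp
next
  case (Cons x F)
  have fixed: "shear \<phi> ` W = W" if "W \<in> set (x # F)" for W
    using Cons.prems that by (intro shear_image[OF \<phi>]) (auto simp: flag_poset_e_def flag_poset_iff)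
  have "shear \<phi> ` (x \<inter> H) = x \<inter> shear \<phi> ` H"
    using fixed[of x] image_Int[OF inj_shear[OF \<phi>], of x H] by simp
  moreover have "map ((`) (shear \<phi>)) F = F"
    using fixed by (intro map_idI) auto
  moreover have "frag_extend (\<lambda>s. frag_of (map ((`) (shear \<phi>)) s)) (cons_frag (x \<inter> H) (flag_cone H F)) =
      cons_frag (shear \<phi> ` (x \<inter> H)) (flag_cone (shear \<phi> ` H) F)"
    using Cons by (simp add: frag_extend_comp flip: Cons.IH)
  ultimately show ?case
    using fixed[of x] by (simp add: frag_extend_diff)
qed

section \<open>Vanishing of the coinvariants\<close>

definition coinv_kernel :: "('v set list \<Rightarrow>\<^sub>0 int) set" where
  "coinv_kernel = {x. Poly_Mapping.lookup x \<in> zspan {(\<lambda>t. push ((`) g) z t - z t) | g z.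
     g \<in> AT scale V V0 \<and> z \<in> cycles (Pposet scale V V0) (dim V0)}}"

lemma coinv_kernel_zero: "0 \<in> coinv_kernel"
  using zspan.zero by (simp add: coinv_kernel_def zero_poly_mapping.rep_eq)

lemma coinv_kernel_add: "x \<in> coinv_kernel \<Longrightarrow> y \<in> coinv_kernel \<Longrightarrow> x + y \<in> coinv_kernel"
  unfolding coinv_kernel_def mem_Collect_eq by (drule (1) zspan.add) (simp add: plus_poly_mapping.rep_eq)

lemma coinv_kernel_sum: "(\<And>i. i \<in> I \<Longrightarrow> f i \<in> coinv_kernel) \<Longrightarrow> sum f I \<in> coinv_kernel"
  by (induction I rule: infinite_finite_induct) (auto intro: coinv_kernel_zero coinv_kernel_add)

lemma coinv_kernel_gen:
  assumes "g \<in> AT scale V V0" "Poly_Mapping.keys x \<subseteq> simplices flag_poset (dim V0)" "frag_bd x = 0"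
  shows "frag_extend (\<lambda>s. frag_of (map ((`) g) s)) x - x \<in> coinv_kernel"
proof -
  have "Poly_Mapping.lookup x \<in> cycles (Pposet scale V V0) (dim V0)"
    using assms(2,3) unfolding in_cycles_iff flag_poset_def by blast
  moreover have "Poly_Mapping.lookup (frag_extend (\<lambda>s. frag_of (map ((`) g) s)) x - x) =
      (\<lambda>t. push ((`) g) (Poly_Mapping.lookup x) t - Poly_Mapping.lookup x t)"
    by (simp add: fun_eq_iff lookup_minus push_lookup)
  ultimately show ?thesis
    using assms(1) unfolding coinv_kernel_def mem_Collect_eq by (intro zspan.gen) blast
qed

text \<open>A single cone on \<open>y\<close> has boundary \<open>y\<close>, but the difference of
  two is a cycle and so gives a generator of the relations.\<close>

lemma shear_cone_diff:
  assumes y: "Poly_Mapping.keys y \<subseteq> simplices flag_poset_e m" "frag_bd y = 0" and n: "dim V0 = Suc m"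
    and H: "hyperplane H" "hyperplane H'"
    and \<phi>: "functional \<phi>" "1 + \<phi> e \<noteq> 0"
  shows "(frag_extend (flag_cone (shear \<phi> ` H)) y - frag_extend (flag_cone (shear \<phi> ` H')) y) -
    (frag_extend (flag_cone H) y - frag_extend (flag_cone H') y) \<in> coinv_kernel"
proof -
  let ?x = "frag_extend (flag_cone H) y - frag_extend (flag_cone H') y"
  have keys: "Poly_Mapping.keys (frag_extend (flag_cone K) y) \<subseteq> simplices flag_poset (dim V0)"
    if "hyperplane K" for K
    using flag_cone_simplices[OF that] n y(1) by (intro keys_frag_extend_subset) auto
  have "frag_bd ?x = 0"
    by (simp add: frag_extend_diff frag_bd_extend_flag_cone y(2))
  moreover have "Poly_Mapping.keys ?x \<subseteq> simplices flag_poset (dim V0)"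
    by (intro keys_frag_diff_subset keys H)
  ultimately have "frag_extend (\<lambda>s. frag_of (map ((`) (shear \<phi>)) s)) ?x - ?x \<in> coinv_kernel"
    by (intro coinv_kernel_gen shear_in_AT \<phi>)
  moreover have "frag_extend (\<lambda>s. frag_of (map ((`) (shear \<phi>)) s)) (frag_extend (flag_cone K) y) =
      frag_extend (flag_cone (shear \<phi> ` K)) y" for K
    unfolding frag_extend_comp
    by (intro frag_extend_cong_on[OF y(1)] map_shear_flag_cone[OF \<phi>]) (simp add: simplices_def)
  ultimately show ?thesis
    by (simp add: frag_extend_diff)
qed

text \<open>The pencil \<open>\<psi>' + t (\<psi> - \<psi>')\<close> joining two hyperplanes is an affine line on which the
  transvections act by translations and the dilations by scalars. Scaling by \<open>c\<close> identifies
  the differences at \<open>(c, 0)\<close> and \<open>(1, 0)\<close>, so the one at \<open>(c, 1)\<close>, a translate of \<open>(c - 1, 0)\<close>,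
  vanishes; scaling back gives \<open>(1, 0)\<close>. This needs \<open>c \<noteq> 0, 1\<close>.\<close>

lemma cone_diff_in_coinv_kernel:
  assumes y: "Poly_Mapping.keys y \<subseteq> simplices flag_poset_e m" "frag_bd y = 0" and n: "dim V0 = Suc m"
    and H: "hyperplane H" "hyperplane H'"
    and c: "(c::'f) \<noteq> 0" "c \<noteq> 1"
  shows "frag_extend (flag_cone H) y - frag_extend (flag_cone H') y \<in> coinv_kernel"
proof -
  obtain \<psi> where \<psi>: "functional \<psi>" "\<psi> e = 1" "H = ker_V \<psi>" using hyperplane_functional[OF H(1)] .
  obtain \<psi>' where \<psi>': "functional \<psi>'" "\<psi>' e = 1" "H' = ker_V \<psi>'" using hyperplane_functional[OF H(2)] .
  define f where "f t v = (1 - t) * \<psi>' v + t * \<psi> v" for t v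
  define K where "K t = frag_extend (flag_cone (ker_V (f t))) y" for t
  have f: "functional (f t)" "f t e = 1" for t
    using functional_comb[OF \<psi>'(1) \<psi>(1), of "1 - t" t] \<psi>(2) \<psi>'(2) by (simp_all add: f_def[abs_def])
  note hyp = hyperplane_ker_V[OF f]
  note fD = functionalD[OF \<psi>(1)] functionalD[OF \<psi>'(1)]
  have translate: "(K (s - a) - K (t - a)) - (K s - K t) \<in> coinv_kernel" for s t a
  proof -
    \<comment> \<open>A transvection: \<open>\<phi> e = 0\<close> because \<open>\<psi>\<close> and
      \<open>\<psi>'\<close> agree at \<open>e\<close>.\<close>
    define \<phi> where "\<phi> = (\<lambda>v. a * \<psi> v + (- a) * \<psi>' v)"
    have \<phi>: "functional \<phi>" "1 + \<phi> e \<noteq> 0"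
      unfolding \<phi>_def using \<psi>(2) \<psi>'(2) by (intro functional_comb \<psi>(1) \<psi>'(1), simp)
    have "shear \<phi> ` ker_V (f t) = ker_V (f (t - a))" for t
      by (rule shear_ker_V[OF \<phi>, of 1])
         (simp_all add: f_def shear_def \<phi>_def fD \<psi>(2) \<psi>'(2) algebra_simps)
    then show ?thesis
      using shear_cone_diff[OF y n hyp hyp \<phi>, of s t] by (simp add: K_def)
  qed
  have dilate: "(K (b * t) - K 0) - (K t - K 0) \<in> coinv_kernel" if "b \<noteq> 0" for b t
  proof -
    \<comment> \<open>The dilation with \<open>1 + \<phi> e = b\<close>. It fixes
      \<open>ker_V \<psi>'\<close>, the origin of the pencil; the zero summand only fits the shape
      of \<open>functional_comb\<close>.\<close>
    define \<phi> where "\<phi> = (\<lambda>v. (b - 1) * \<psi>' v + 0 * \<psi>' v)"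
    have \<phi>: "functional \<phi>" "1 + \<phi> e \<noteq> 0"
      unfolding \<phi>_def using \<psi>'(2) that by (intro functional_comb \<psi>'(1), simp)
    have "shear \<phi> ` ker_V (f t) = ker_V (f (b * t))" for t
      by (rule shear_ker_V[OF \<phi> that])
         (simp add: f_def shear_def \<phi>_def fD \<psi>(2) \<psi>'(2) algebra_simps)
    from this[of t] this[of 0] show ?thesis
      using shear_cone_diff[OF y n hyp hyp \<phi>, of t 0] by (simp add: K_def)
  qed
  have "K c - K 1 \<in> coinv_kernel"
    using dilate[OF c(1), of 1] by simp
  with translate[of c 1 1] have "((K (c - 1) - K 0) - (K c - K 1)) + (K c - K 1) \<in> coinv_kernel"
    by (intro coinv_kernel_add) simp_all
  then have "K (c - 1) - K 0 \<in> coinv_kernel" by simp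
  moreover have "(K 1 - K 0) - (K (c - 1) - K 0) \<in> coinv_kernel"
    using dilate[of "1 / (c - 1)" "c - 1"] c(2) by simp
  ultimately have "((K 1 - K 0) - (K (c - 1) - K 0)) + (K (c - 1) - K 0) \<in> coinv_kernel"
    by (intro coinv_kernel_add)
  then have "K 1 - K 0 \<in> coinv_kernel" by simp
  moreover have "f 1 = \<psi>" "f 0 = \<psi>'" by (auto simp: f_def)
  ultimately show ?thesis
    by (simp add: K_def \<psi>(3) \<psi>'(3))
qed

lemma top_cycle_in_coinv_kernel:
  assumes z: "Poly_Mapping.keys z \<subseteq> simplices flag_poset (dim V0)" "frag_bd z = 0"
    and c: "(c::'f) \<noteq> 0" "c \<noteq> 1"
  shows "z \<in> coinv_kernel"
proof -
  have "dim V0 \<noteq> 0"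
  proof
    assume 0: "dim V0 = 0"
    obtain D where D: "finite D" "span D = V" by (rule V_spanned)
    have "dim {0} < dim V0"
      using e_in_V0 e_nonzero D V0_subset subspace_0[OF subspace_V0]
      by (intro dim_less_of_psubset[of _ _ D] subspace_V0) auto
    with 0 show False by simp
  qed
  then obtain m where n: "dim V0 = Suc m" using not0_implies_Suc by blast
  obtain S y where S: "finite S" "\<And>H. H \<in> S \<Longrightarrow> hyperplane H"
    and y: "\<And>H. H \<in> S \<Longrightarrow> Poly_Mapping.keys (y H) \<subseteq> simplices flag_poset_e m"
      "\<And>H. H \<in> S \<Longrightarrow> frag_bd (y H) = 0"
    and z_eq: "z = (\<Sum>H\<in>S. frag_extend (flag_cone H) (y H))"
    using cycle_eq_sum_cones[OF z n] by blast
  show ?thesis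
  proof (cases "S = {}")
    case True
    then show ?thesis using z_eq coinv_kernel_zero by simp
  next
    case False
    then obtain H0 where H0: "H0 \<in> S" by blast
    \<comment> \<open>The cycles \<open>y H\<close> sum to zero, so moving every apex to the fixed
      \<open>H0\<close> gives total zero, which can be subtracted from \<open>z\<close>.\<close>
    have "(\<Sum>H\<in>S. y H) = frag_bd z"
      using y(2) by (simp add: z_eq frag_extend_sum[OF S(1)] comp_def frag_bd_extend_flag_cone)
    then have "(\<Sum>H\<in>S. frag_extend (flag_cone H0) (y H)) = 0"
      using frag_extend_sum[OF S(1), of "flag_cone H0" y] z(2) by (simp add: comp_def)
    then have "z = (\<Sum>H\<in>S. frag_extend (flag_cone H) (y H) - frag_extend (flag_cone H0) (y H))"
      using z_eq by (simp add: sum_subtractf)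
    then show ?thesis
      using cone_diff_in_coinv_kernel[OF y n S(2) S(2)[OF H0] c] by (simp add: coinv_kernel_sum)
  qed
qed

end

theorem theorem3p9:
  fixes scale :: "'f::field \<Rightarrow> 'v::ab_group_add \<Rightarrow> 'v"
    and V V0 :: "'v set"
  assumes "Vector_Spaces.vector_space scale"
    and "card (UNIV :: 'f set) \<noteq> 2"
    and "Modules.module.subspace scale V"
    and "\<exists>B. finite B \<and> B \<subseteq> V \<and> Modules.module.span scale B = V"
    and "Modules.module.subspace scale V0"
    and "V0 \<subseteq> V"
    and "V0 \<noteq> {0}"
  shows "coinvariants_vanish (Pposet scale V V0) (Vector_Spaces.vector_space.dim scale V0)
           (AT scale V V0) (\<lambda>g W. g ` W)"
proof -
  interpret vector_space scale by fact
  \<comment> \<open>Infinite fields are covered as well, since their \<open>card\<close> is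
    \<open>0\<close>.\<close>
  have "\<exists>c::'f. c \<noteq> 0 \<and> c \<noteq> 1"
  proof (rule ccontr)
    assume "\<not> (\<exists>c::'f. c \<noteq> 0 \<and> c \<noteq> 1)"
    then have "(UNIV :: 'f set) = {0, 1}" by auto
    then have "card (UNIV :: 'f set) = card {0, 1 :: 'f}" by simp
    with assms(2) show False by simp
  qed
  then obtain c :: 'f where c: "c \<noteq> 0" "c \<noteq> 1" by blast
  obtain e where e: "e \<in> V0" "e \<noteq> 0"
    using assms(5,7) subspace_0 by blast
  interpret relative_flags scale V V0 e
    by unfold_locales (use assms(3-6) e in auto)
  show ?thesis
  proof (rule coinvariants_vanishI)
    fix x :: "'v set list \<Rightarrow>\<^sub>0 int"
    assume "Poly_Mapping.keys x \<subseteq> simplices (Pposet scale V V0) (dim V0)" "frag_bd x = 0"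
    then have "x \<in> coinv_kernel"
      by (intro top_cycle_in_coinv_kernel[OF _ _ c]) (simp_all add: flag_poset_def)
    then show "Poly_Mapping.lookup x \<in> zspan {(\<lambda>t. push ((`) g) z t - z t) | g z.
        g \<in> AT scale V V0 \<and> z \<in> cycles (Pposet scale V V0) (dim V0)}"
      by (simp add: coinv_kernel_def)
  qed
qed

end
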